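(* In the setting described in the context, there exist $\mu_1,\mu_2,\nu_1,\nu_2\in\mathbb{R}$ such that, with $\gamma_1,\gamma_2,\zeta_1,\zeta_2\in\mathbb{R}$ computed from $$\begin{bmatrix}\mu_1&\mu_2&\nu_1&\nu_2\end{bmatrix}^\top=\Omega^\top\begin{bmatrix}\gamma_1&\gamma_2&\zeta_1&\zeta_2\end{bmatrix}^\top$$ (and satisfying $\gamma_1^2+\gamma_2^2+\zeta_1^2+\zeta_2^2=1$), the real vectors $x,y\in\mathbb{R}^n$ defined by $$x+iy=\begin{bmatrix}z_1&z_2\end{bmatrix}\begin{bmatrix}\gamma_1+i\zeta_1\\ \gamma_2+i\zeta_2\end{bmatrix}$$ satisfy $x^\top y=0$ and $\|x\|_2=\|y\|_2=\frac{\sqrt2}{2}$. Moreover, for any such $\mu_1,\mu_2,\nu_1,\nu_2$, with the corresponding $\gamma_1,\gamma_2,\zeta_1,\zeta_2$, $x$, $y$, and with $$w=\begin{bmatrix}w_1&w_2\end{bmatrix}\begin{bmatrix}\gamma_1+i\zeta_1\\ \gamma_2+i\zeta_2\end{bmatrix},$$ the vectors $x_{j+1}=x$, $x_{j+2}=y$, $v_{j+1}=\mathrm{Re}(w)$, $v_{j+2}=\mathrm{Im}(w)$ satisfy the constraints $$Q_2^\top\left(A\begin{bmatrix}x_{j+1}&x_{j+2}\end{bmatrix}-X_j\begin{bmatrix}v_{j+1}&v_{j+2}\end{bmatrix}-\begin{bmatrix}x_{j+1}&x_{j+2}\end{bmatrix}D_0\right)=0,$$ $$X_j^\top\begin{bmatrix}x_{j+1}&x_{j+2}\end{bmatrix}=0,\qquad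 \begin{bmatrix}x_{j+1}&x_{j+2}\end{bmatrix}^\top\begin{bmatrix}x_{j+1}&x_{j+2}\end{bmatrix}=\begin{bmatrix}1/\delta_1^2&0\\ 0&1/\delta_2^2\end{bmatrix}$$ with $\delta_1=1/\|x_{j+1}\|_2$, $\delta_2=1/\|x_{j+2}\|_2$, and the corresponding value of the objective function satisfies $$\|\delta_1v_{j+1}\|_2^2+\|\delta_2v_{j+2}\|_2^2+\beta_{j+1}^2\left(\frac{\delta_1}{\delta_2}-\frac{\delta_2}{\delta_1}\right)^2\le\frac{2(1-\sigma_2^2)}{\sigma_2^2}.$$
   Context: Setting. $A\in\mathbb{R}^{n\times n}$, $B\in\mathbb{R}^{n\times m}$ has full column rank, and $(A,B)$ is controllable, i.e. $\begin{bmatrix}B&AB&\cdots&A^{n-1}B\end{bmatrix}$ has full row rank. Let $B=Q\begin{bmatrix}R\\ 0\end{bmatrix}$ be a QR decomposition with $Q=\begin{bmatrix}Q_1&Q_2\end{bmatrix}\in\mathbb{R}^{n\times n}$ orthogonal, $Q_1\in\mathbb{R}^{n\times m}$, $Q_2\in\mathbb{R}^{n\times(n-m)}$, and $R\in\mathbb{R}^{m\times m}$ nonsingular upper triangular. Let $1\le j\le n-2$, and let $X_j\in\mathbb{R}^{n\times j}$ and an upper quasi-triangular $T_j\in\mathbb{R}^{j\times j}$ (diagonal blocks of size $1\times1$ or $2\times2$) satisfy $Q_2^\top(AX_j-X_jT_j)=0$ and $X_j^\top X_j=I_j$. Let $\lambda_{j+1}=\alpha_{j+1}+i\beta_{j+1}$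 with $\alpha_{j+1},\beta_{j+1}\in\mathbb{R}$, $\beta_{j+1}\neq0$, and set $$D_0=\begin{bmatrix}\alpha_{j+1}&\beta_{j+1}\\ -\beta_{j+1}&\alpha_{j+1}\end{bmatrix},\qquad M_{j+1}=\begin{bmatrix}Q_2^\top(A-(\alpha_{j+1}+i\beta_{j+1})I_n)&-Q_2^\top X_j\\ {X_j^\top}&0\end{bmatrix}.$$ Let $r$ be the dimension of the null space of $M_{j+1}$ in $\mathbb{C}^{n+j}$, and let the columns of $S=\begin{bmatrix}S_1\\ S_2\end{bmatrix}\in\mathbb{C}^{(n+j)\times r}$, with $S_1\in\mathbb{C}^{n\times r}$, $S_2\in\mathbb{C}^{j\times r}$, form an orthonormal basis of this null space. Let $S_1=U\Sigma V^*$ be a singular value decomposition ($U$, $V$ unitary, singular values in decreasing order). Assume $r\ge2$ and that the two largest singular values $\sigma_1\ge\sigma_2$ of $S_1$ are positive. Let $e_k$ be the $k$-th column of the identity matrix and $u_k=Ue_k$, and put $$z_1=u_1=\frac{S_1Ve_1}{\sigma_1},\quad w_1=\frac{S_2Ve_1}{\sigma_1},\quad z_2=u_2=\frac{S_1Ve_2}{\sigma_2},\quad w_2=\frac{S_2Ve_2}{\sigma_2}.$$ Write $z_k=\tilde x_k+i\tilde y_k$ with $\tilde x_k,\tilde y_k\in\mathbb{R}^n$ ($k=1,2$), $\tilde X=\begin{bmatrix}\tilde x_1&\tilde x_2\end{bmatrix}$, $\tilde Y=\begin{bmatrix}\tilde y_1&\tilde y_2\end{bmatrix}\in\mathbb{R}^{n\times2}$.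 The matrix $\Omega$. Let $\begin{bmatrix}p_1\\ {q_1}\end{bmatrix},\begin{bmatrix}p_2\\ {q_2}\end{bmatrix}\in\mathbb{R}^4$ ($p_k,q_k\in\mathbb{R}^2$) be orthonormal right singular vectors of the $n\times4$ real matrix $\begin{bmatrix}\tilde Y&\tilde X\end{bmatrix}$ corresponding to its two smallest singular values (the singular values being the square roots of the four eigenvalues, with multiplicity, of $\begin{bmatrix}\tilde Y&\tilde X\end{bmatrix}^\top\begin{bmatrix}\tilde Y&\tilde X\end{bmatrix}$), and let $$\Omega=\begin{bmatrix}p_1&p_2&-q_1&-q_2\\ {q_1}&q_2&p_1&p_2\end{bmatrix}\in\mathbb{R}^{4\times4}.$$ The right singular vectors are assumed chosen so that $\Omega$ is orthogonal (this is automatic unless all four singular values equal $\frac{\sqrt2}{2}$). *)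

theory Defs
  imports
    "Jordan_Normal_Form.Schur_Decomposition"
    "Jordan_Normal_Form.Matrix_Kernel"
    "Jordan_Normal_Form.DL_Rank"
begin

text \<open>
  Indices are 0-based, so row, column and singular value number \<open>k\<close> of the mathematical text has
  index \<open>k - 1\<close> here.
\<close>

abbreviation cmat :: "real mat \<Rightarrow> complex mat" where
  "cmat \<equiv> map_mat complex_of_real"

definition append_cols :: "'a::zero mat \<Rightarrow> 'a mat \<Rightarrow> 'a mat" (infixr "@\<^sub>c" 65) where
  "A @\<^sub>c B = four_block_mat A B (0\<^sub>m 0 (dim_col A)) (0\<^sub>m 0 (dim_col B))"

definition l2_norm :: "real vec \<Rightarrow> real" where
  "l2_norm v = sqrt (v \<bullet> v)"

text \<open>
  The library's \<open>orthogonal_mat\<close> and \<open>corthogonal_mat\<close> only ask for pairwise orthogonal, nonzero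
  columns, so they cannot be used for the normalised notions below.
\<close>

definition real_orthogonal :: "real mat \<Rightarrow> bool" where
  "real_orthogonal Q \<longleftrightarrow> square_mat Q \<and> Q\<^sup>T * Q = 1\<^sub>m (dim_row Q)"

definition unitary :: "complex mat \<Rightarrow> bool" where
  "unitary U \<longleftrightarrow> square_mat U \<and> mat_adjoint U * U = 1\<^sub>m (dim_row U)"

definition controllability_mat :: "real mat \<Rightarrow> real mat \<Rightarrow> real mat" where
  "controllability_mat A B =
     mat_of_cols (dim_row A) (concat (map (\<lambda>k. cols (A ^\<^sub>m k * B)) [0..<dim_row A]))"

definition controllable :: "real mat \<Rightarrow> real mat \<Rightarrow> bool" where
  "controllable A B \<longleftrightarrow> vec_space.rank (dim_row A) (controllability_mat A B) = dim_row A"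

inductive upper_quasi_triangular :: "real mat \<Rightarrow> bool" where
  empty: "upper_quasi_triangular (0\<^sub>m 0 0)"
| block: "D \<in> carrier_mat s s \<Longrightarrow> s = 1 \<or> s = 2 \<Longrightarrow> E \<in> carrier_mat s k \<Longrightarrow>
    T \<in> carrier_mat k k \<Longrightarrow> upper_quasi_triangular T \<Longrightarrow>
    upper_quasi_triangular (four_block_mat D E (0\<^sub>m k s) T)"

definition orthonormal_kernel_basis :: "complex mat \<Rightarrow> complex mat \<Rightarrow> bool" where
  "orthonormal_kernel_basis M S \<longleftrightarrow>
     mat_adjoint S * S = 1\<^sub>m (dim_col S) \<and> kernel.basis (dim_col M) M (set (cols S))"

definition is_svd :: "complex mat \<Rightarrow> complex mat \<Rightarrow> (nat \<Rightarrow> real) \<Rightarrow> complex mat \<Rightarrow> bool" where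
  "is_svd C U \<sigma> V \<longleftrightarrow>
     U \<in> carrier_mat (dim_row C) (dim_row C) \<and> unitary U \<and>
     V \<in> carrier_mat (dim_col C) (dim_col C) \<and> unitary V \<and>
     (\<forall>i < min (dim_row C) (dim_col C). 0 \<le> \<sigma> i) \<and>
     (\<forall>i k. i \<le> k \<and> k < min (dim_row C) (dim_col C) \<longrightarrow> \<sigma> k \<le> \<sigma> i) \<and>
     C = U * mat (dim_row C) (dim_col C) (\<lambda>(i, k). if i = k then complex_of_real (\<sigma> i) else 0)
           * mat_adjoint V"

text \<open>
  Singular values in increasing order, one for each column: the square roots of the eigenvalues
  of \<open>C\<^sup>T * C\<close>, repeated according to multiplicity (\<open>C\<^sup>T * C\<close> is symmetric, so its characteristic
  polynomial splits over the reals).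
\<close>

definition singular_values :: "real mat \<Rightarrow> real list" where
  "singular_values C = sorted_list_of_multiset (image_mset sqrt (proots (char_poly (C\<^sup>T * C))))"

definition right_singular_vector :: "real mat \<Rightarrow> real \<Rightarrow> real vec \<Rightarrow> bool" where
  "right_singular_vector C s v \<longleftrightarrow>
     v \<in> carrier_vec (dim_col C) \<and> l2_norm v = 1 \<and> (C\<^sup>T * C) *\<^sub>v v = s\<^sup>2 \<cdot>\<^sub>v v"

text \<open>
  No order is imposed on the two vectors: \<open>v1\<close> may belong to the smallest singular value and \<open>v2\<close>
  to the second smallest one, or vice versa.
\<close>

definition smallest_two_right_singular_vectors ::
    "real mat \<Rightarrow> real vec \<Rightarrow> real vec \<Rightarrow> bool" where
  "smallest_two_right_singular_vectors C v1 v2 \<longleftrightarrow>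
     (\<exists>s1 s2. {#s1, s2#} = mset (take 2 (singular_values C)) \<and>
        right_singular_vector C s1 v1 \<and> right_singular_vector C s2 v2) \<and> v1 \<bullet> v2 = 0"

definition Omega_mat :: "real vec \<Rightarrow> real vec \<Rightarrow> real vec \<Rightarrow> real vec \<Rightarrow> real mat" where
  "Omega_mat p1 q1 p2 q2 =
     mat_of_cols 4 [p1 @\<^sub>v q1, p2 @\<^sub>v q2, (- q1) @\<^sub>v p1, (- q2) @\<^sub>v p2]"

definition M_mat :: "real mat \<Rightarrow> real mat \<Rightarrow> real mat \<Rightarrow> complex \<Rightarrow> complex mat" where
  "M_mat A Q2 X l =
     four_block_mat ((cmat Q2)\<^sup>T * (cmat A - l \<cdot>\<^sub>m 1\<^sub>m (dim_row A))) (- ((cmat Q2)\<^sup>T * cmat X))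
                    ((cmat X)\<^sup>T) (0\<^sub>m (dim_col X) (dim_col X))"

text \<open>The vector \<open>[a b] [\<gamma>1 + i \<zeta>1, \<gamma>2 + i \<zeta>2]\<^sup>T\<close>.\<close>

definition combine ::
    "complex vec \<Rightarrow> complex vec \<Rightarrow> real \<Rightarrow> real \<Rightarrow> real \<Rightarrow> real \<Rightarrow> complex vec" where
  "combine a b \<gamma>1 \<gamma>2 \<zeta>1 \<zeta>2 =
     mat_of_cols (dim_vec a) [a, b] *\<^sub>v vec_of_list [Complex \<gamma>1 \<zeta>1, Complex \<gamma>2 \<zeta>2]"

definition admissible ::
    "real mat \<Rightarrow> complex vec \<Rightarrow> complex vec \<Rightarrow> real \<Rightarrow> real \<Rightarrow> real \<Rightarrow> real \<Rightarrow>
     real \<Rightarrow> real \<Rightarrow> real \<Rightarrow> real \<Rightarrow> real vec \<Rightarrow> real vec \<Rightarrow> bool" where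
  "admissible \<Omega> z1 z2 \<mu>1 \<mu>2 \<nu>1 \<nu>2 \<gamma>1 \<gamma>2 \<zeta>1 \<zeta>2 x y \<longleftrightarrow>
     vec_of_list [\<mu>1, \<mu>2, \<nu>1, \<nu>2] = \<Omega>\<^sup>T *\<^sub>v vec_of_list [\<gamma>1, \<gamma>2, \<zeta>1, \<zeta>2] \<and>
     \<gamma>1\<^sup>2 + \<gamma>2\<^sup>2 + \<zeta>1\<^sup>2 + \<zeta>2\<^sup>2 = 1 \<and>
     x = map_vec Re (combine z1 z2 \<gamma>1 \<gamma>2 \<zeta>1 \<zeta>2) \<and>
     y = map_vec Im (combine z1 z2 \<gamma>1 \<gamma>2 \<zeta>1 \<zeta>2) \<and>
     x \<bullet> y = 0 \<and> l2_norm x = sqrt 2 / 2 \<and> l2_norm y = sqrt 2 / 2"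

end

theory Submission
  imports Defs
begin

text \<open>
  Existence does not use \<open>\<Omega>\<close>: with \<open>z = z\<^sub>1 c\<^sub>1 + z\<^sub>2 c\<^sub>2\<close>, the conditions \<open>x \<bullet> y = 0\<close> and
  \<open>\<bar>x\<bar> = \<bar>y\<bar>\<close> say that the bilinear square \<open>z \<bullet> z\<close>, a binary complex quadratic form in
  \<open>(c\<^sub>1, c\<^sub>2)\<close>, vanishes, and every such form has an isotropic unit vector. For the bound, \<open>z\<close> and
  \<open>w\<close> are the two halves of a kernel vector \<open>S V f\<close> of \<open>M\<close> with
  \<open>f = (c\<^sub>1 / \<sigma>\<^sub>1, c\<^sub>2 / \<sigma>\<^sub>2, 0, \<dots>)\<close>. Since \<open>S V\<close> and \<open>U\<close> are isometries,
  \<open>1 + \<bar>w\<bar>\<^sup>2 = \<bar>f\<bar>\<^sup>2 \<le> 1 / \<sigma>\<^sub>2\<^sup>2\<close>.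
\<close>

section \<open>Isotropic vectors of binary complex quadratic forms\<close>

lemma binary_quadratic_form_isotropic:
  fixes a b d :: complex
  obtains c1 c2 where "(cmod c1)\<^sup>2 + (cmod c2)\<^sup>2 = 1" "a * c1\<^sup>2 + b * c1 * c2 + d * c2\<^sup>2 = 0"
proof -
  obtain u v where uv: "a * u\<^sup>2 + b * u * v + d * v\<^sup>2 = 0" "u \<noteq> 0 \<or> v \<noteq> 0"
  proof (cases "a = 0")
    case True
    then show ?thesis by (intro that[of 1 0]) auto
  next
    case False
    define s where "s = csqrt (b\<^sup>2 - 4 * a * d)"
    have s: "s\<^sup>2 = b\<^sup>2 - 4 * a * d" by (simp add: s_def)
    \<comment> \<open>The quadratic formula gives the ratio
      \<open>u / v = (s - b) / (2 * a)\<close>. Clearing the denominator yields the witness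
      \<open>(s - b, 2 * a)\<close>, which is nonzero because of its second entry.\<close>
    have "a * (s - b)\<^sup>2 + b * (s - b) * (2 * a) + d * (2 * a)\<^sup>2 = a * (s\<^sup>2 - (b\<^sup>2 - 4 * a * d))"
      by (simp add: algebra_simps power2_eq_square)
    then show ?thesis using False s by (intro that[of "s - b" "2 * a"]) auto
  qed
  \<comment> \<open>The form is homogeneous of degree 2, so dividing by the length \<open>N\<close>
    keeps its value at zero.\<close>
  define N where "N = sqrt ((cmod u)\<^sup>2 + (cmod v)\<^sup>2)"
  have N2: "N\<^sup>2 = (cmod u)\<^sup>2 + (cmod v)\<^sup>2" by (simp add: N_def)
  have N: "N > 0" using uv(2) by (simp add: N_def sum_power2_gt_zero_iff)
  show ?thesis
  proof (rule that[of "u / of_real N" "v / of_real N"])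
    show "(cmod (u / of_real N))\<^sup>2 + (cmod (v / of_real N))\<^sup>2 = 1"
      using N by (simp add: norm_divide power_divide N2[symmetric] flip: add_divide_distrib)
    have "a * (u / of_real N)\<^sup>2 + b * (u / of_real N) * (v / of_real N) + d * (v / of_real N)\<^sup>2
        = (a * u\<^sup>2 + b * u * v + d * v\<^sup>2) / (of_real N)\<^sup>2"
      using N by (simp add: field_simps power2_eq_square)
    then show "a * (u / of_real N)\<^sup>2 + b * (u / of_real N) * (v / of_real N)
        + d * (v / of_real N)\<^sup>2 = 0"
      using uv(1) by simp
  qed
qed

section \<open>Adjoints, isometries and the Hermitian inner product\<close>

lemma mat_adjoint_index:
  "i < dim_col A \<Longrightarrow> k < dim_row A \<Longrightarrow> mat_adjoint A $$ (i, k) = conjugate (A $$ (k, i))"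
  by (simp add: mat_adjoint_def mat_of_rows_def)

lemma mat_adjoint_carrier[simp, intro]:
  "A \<in> carrier_mat nr nc \<Longrightarrow> mat_adjoint A \<in> carrier_mat nc nr"
  by (auto simp: mat_adjoint_def)

lemma cscalar_prod_adjoint:
  fixes A :: "complex mat"
  assumes A: "A \<in> carrier_mat nr nc" and u: "u \<in> carrier_vec nc" and v: "v \<in> carrier_vec nr"
  shows "(A *\<^sub>v u) \<bullet>c v = u \<bullet>c (mat_adjoint A *\<^sub>v v)"
proof -
  have "(A *\<^sub>v u) \<bullet>c v = (\<Sum>k = 0..<nr. (\<Sum>i = 0..<nc. A $$ (k, i) * u $ i) * cnj (v $ k))"
    using A u v by (simp add: scalar_prod_def)
  also have "\<dots> = (\<Sum>i = 0..<nc. \<Sum>k = 0..<nr. A $$ (k, i) * u $ i * cnj (v $ k))"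
    by (simp add: sum_distrib_right sum.swap[of _ "{0..<nr}"])
  also have "\<dots> = (\<Sum>i = 0..<nc. u $ i * cnj (\<Sum>k = 0..<nr. mat_adjoint A $$ (i, k) * v $ k))"
    using A by (intro sum.cong refl) (simp add: mat_adjoint_index sum_distrib_left mult_ac)
  also have "\<dots> = u \<bullet>c (mat_adjoint A *\<^sub>v v)"
    using u v carrier_matD[OF mat_adjoint_carrier[OF A]] by (simp add: scalar_prod_def)
  finally show ?thesis .
qed

text \<open>Moving \<open>A\<close> to the other side of the inner product produces
  \<open>mat_adjoint A * A\<close>. The hypothesis asks only for a left inverse, so that the lemma
  covers the possibly rectangular \<open>S\<close> as well as \<open>U\<close> and
  \<open>V\<close>.\<close>

lemma isometry_cscalar_prod:
  fixes A :: "complex mat"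
  assumes A: "A \<in> carrier_mat nr nc" and iso: "mat_adjoint A * A = 1\<^sub>m nc"
    and u: "u \<in> carrier_vec nc" and v: "v \<in> carrier_vec nc"
  shows "(A *\<^sub>v u) \<bullet>c (A *\<^sub>v v) = u \<bullet>c v"
proof -
  have "mat_adjoint A *\<^sub>v (A *\<^sub>v v) = v"
    using v iso assoc_mult_mat_vec[OF mat_adjoint_carrier[OF A] A v] by simp
  then show ?thesis
    using cscalar_prod_adjoint[OF A u, of "A *\<^sub>v v"] A v by simp
qed

lemma cscalar_prod_append:
  fixes u v :: "complex vec"
  assumes "u \<in> carrier_vec k" "v \<in> carrier_vec l"
  shows "(u @\<^sub>v v) \<bullet>c (u @\<^sub>v v) = u \<bullet>c u + v \<bullet>c v"
proof -
  have "conjugate (u @\<^sub>v v) = conjugate u @\<^sub>v conjugate v"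
    by (rule eq_vecI) auto
  then show ?thesis
    using assms by (simp add: scalar_prod_append)
qed

section \<open>Norms, real and imaginary parts\<close>

lemma l2_norm_sq: "(l2_norm v)\<^sup>2 = v \<bullet> v"
  by (simp add: l2_norm_def scalar_prod_def sum_nonneg)

lemma cscalar_prod_self_Re_Im:
  "z \<bullet>c z = complex_of_real
     (map_vec Re z \<bullet> map_vec Re z + map_vec Im z \<bullet> map_vec Im z)"
proof -
  have "z \<bullet>c z = (\<Sum>i = 0..<dim_vec z. z $ i * cnj (z $ i))"
    by (simp add: scalar_prod_def)
  also have "\<dots> = of_real (\<Sum>i = 0..<dim_vec z. Re (z $ i) * Re (z $ i) + Im (z $ i) * Im (z $ i))"
    by (simp add: complex_mult_cnj power2_eq_square)
  finally show ?thesis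
    by (simp add: scalar_prod_def sum.distrib)
qed

text \<open>The product here has no conjugation. A single complex equation
  \<open>z \<bullet> z = 0\<close> therefore encodes two real conditions: the real and imaginary
  parts of \<open>z\<close> have equal norm and are orthogonal.\<close>

lemma scalar_prod_self_Re_Im:
  "z \<bullet> z = Complex (map_vec Re z \<bullet> map_vec Re z - map_vec Im z \<bullet> map_vec Im z)
     (2 * (map_vec Re z \<bullet> map_vec Im z))"
  by (simp add: complex_eq_iff scalar_prod_def sum_subtractf sum_distrib_left mult.commute)

lemma map_vec_Re_cmat_mult:
  assumes "A \<in> carrier_mat nr nc" "z \<in> carrier_vec nc"
  shows "map_vec Re (cmat A *\<^sub>v z) = A *\<^sub>v map_vec Re z"
  using assms by (intro eq_vecI) (auto simp: scalar_prod_def)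

lemma map_vec_Im_cmat_mult:
  assumes "A \<in> carrier_mat nr nc" "z \<in> carrier_vec nc"
  shows "map_vec Im (cmat A *\<^sub>v z) = A *\<^sub>v map_vec Im z"
  using assms by (intro eq_vecI) (auto simp: scalar_prod_def)

lemma mult_mat_of_cols:
  assumes "A \<in> carrier_mat nr nc" "set vs \<subseteq> carrier_vec nc"
  shows "A * mat_of_cols nc vs = mat_of_cols nr (map ((*\<^sub>v) A) vs)"
  using assms by (intro eq_matI) (auto simp: mat_of_cols_index subset_code(1))

lemma combine_eq:
  assumes "a \<in> carrier_vec k" "b \<in> carrier_vec k"
  shows "combine a b \<gamma>1 \<gamma>2 \<zeta>1 \<zeta>2 = Complex \<gamma>1 \<zeta>1 \<cdot>\<^sub>v a + Complex \<gamma>2 \<zeta>2 \<cdot>\<^sub>v b"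
  using assms unfolding combine_def
  by (intro eq_vecI) (auto simp: scalar_prod_def mat_of_cols_index numeral_2_eq_2 mult.commute)

lemma admissible_norms:
  assumes "admissible \<Omega> z1 z2 \<mu>1 \<mu>2 \<nu>1 \<nu>2 \<gamma>1 \<gamma>2 \<zeta>1 \<zeta>2 x y"
  shows "x \<bullet> x = 1/2" "y \<bullet> y = 1/2"
proof -
  have "l2_norm x = sqrt 2 / 2" "l2_norm y = sqrt 2 / 2"
    using assms by (auto simp: admissible_def)
  then show "x \<bullet> x = 1/2" "y \<bullet> y = 1/2"
    unfolding l2_norm_sq[symmetric] by (simp_all only: power_divide) simp_all
qed

section \<open>Kernel bases and singular value decompositions\<close>

lemma orthonormal_kernel_basis_mult:
  assumes M: "M \<in> carrier_mat nr nc" and S: "S \<in> carrier_mat nc k"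
    and basis: "orthonormal_kernel_basis M S" and v: "v \<in> carrier_vec k"
  shows "M *\<^sub>v (S *\<^sub>v v) = 0\<^sub>v nr"
proof -
  interpret kernel nr nc M by standard (rule M)
  have "set (cols S) \<subseteq> mat_kernel M"
    using basis carrier_matD(2)[OF M] unfolding orthonormal_kernel_basis_def
    by (simp add: Ker.basis_def)
  then have col: "M *\<^sub>v col S i = 0\<^sub>v nr" if "i < k" for i
    using S that by (intro mat_kernelD(2)[OF M]) (auto simp: cols_def)
  \<comment> \<open>The product vanishes column by column, since each column of \<open>S\<close>
    lies in the kernel of \<open>M\<close>.\<close>
  have "M * S = 0\<^sub>m nr k"
  proof (rule eq_matI)
    fix i l assume il: "i < dim_row (0\<^sub>m nr k)" "l < dim_col (0\<^sub>m nr k)"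
    then have "(M * S) $$ (i, l) = (M *\<^sub>v col S l) $ i"
      using M S by simp
    then show "(M * S) $$ (i, l) = 0\<^sub>m nr k $$ (i, l)"
      using il col[of l] by simp
  qed (use M S in auto)
  moreover have "0\<^sub>m nr k *\<^sub>v v = 0\<^sub>v nr"
    using v by (intro eq_vecI) auto
  ultimately show ?thesis
    using assoc_mult_mat_vec[OF M S v] by simp
qed

text \<open>The factor \<open>mat_adjoint V\<close> cancels \<open>V\<close>, which leaves the
  rectangular diagonal factor acting on \<open>f\<close>. The case distinction on
  \<open>i < r\<close> pads with zeros when \<open>C\<close> has more rows than columns.\<close>

lemma is_svd_mult_vec:
  assumes svd: "is_svd C U \<sigma> V" and C: "C \<in> carrier_mat n r" and f: "f \<in> carrier_vec r"
  shows "C *\<^sub>v (V *\<^sub>v f) =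
    U *\<^sub>v vec n (\<lambda>i. if i < r then complex_of_real (\<sigma> i) * f $ i else 0)"
proof -
  define D where "D = mat n r (\<lambda>(i, k). if i = k then complex_of_real (\<sigma> i) else 0)"
  have D: "D \<in> carrier_mat n r" by (simp add: D_def)
  have U: "U \<in> carrier_mat n n" and V: "V \<in> carrier_mat r r"
    and VV: "mat_adjoint V * V = 1\<^sub>m r" and Ceq: "C = U * D * mat_adjoint V"
    using svd C unfolding is_svd_def unitary_def D_def by auto
  have Vf: "V *\<^sub>v f \<in> carrier_vec r" using V f by simp
  have "mat_adjoint V *\<^sub>v (V *\<^sub>v f) = f"
    using assoc_mult_mat_vec[OF mat_adjoint_carrier[OF V] V f] VV f by simp
  then have "C *\<^sub>v (V *\<^sub>v f) = U *\<^sub>v (D *\<^sub>v f)"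
    unfolding Ceq using U D Vf mat_adjoint_carrier[OF V] f
    by (simp add: assoc_mult_mat_vec[of _ n r _ r] assoc_mult_mat_vec[of _ n n _ r])
  also have "D *\<^sub>v f = vec n (\<lambda>i. if i < r then complex_of_real (\<sigma> i) * f $ i else 0)"
    using f by (intro eq_vecI)
      (auto simp: D_def scalar_prod_def if_distrib[of "\<lambda>x. x * _"] cong: if_cong)
  finally show ?thesis .
qed

text \<open>A coefficient vector supported on the first two coordinates. The length is a parameter
  because such vectors occur both in dimension \<open>r\<close>, before \<open>S1\<close> is
  applied, and in dimension \<open>n\<close>, after it.\<close>

definition pair_vec :: "nat \<Rightarrow> complex \<Rightarrow> complex \<Rightarrow> complex vec" where
  "pair_vec k a b = a \<cdot>\<^sub>v unit_vec k 0 + b \<cdot>\<^sub>v unit_vec k 1"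

lemma pair_vec_carrier[simp]: "pair_vec k a b \<in> carrier_vec k"
  by (simp add: pair_vec_def)

lemma mult_mat_pair_vec:
  assumes "A \<in> carrier_mat nr k"
  shows "A *\<^sub>v pair_vec k a b = a \<cdot>\<^sub>v (A *\<^sub>v unit_vec k 0) + b \<cdot>\<^sub>v (A *\<^sub>v unit_vec k 1)"
  using assms unfolding pair_vec_def
  by (simp add: mult_add_distrib_mat_vec[OF assms] mult_mat_vec[OF assms])

lemma pair_vec_cscalar_prod:
  assumes "2 \<le> k"
  shows "pair_vec k a b \<bullet>c pair_vec k a b = of_real ((cmod a)\<^sup>2 + (cmod b)\<^sup>2)"
proof -
  \<comment> \<open>Splitting each summand into two indicator terms lets both sums collapse; indices
    0 and 1 are in range because \<open>2 \<le> k\<close>.\<close>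
  have "pair_vec k a b \<bullet>c pair_vec k a b
      = (\<Sum>i = 0..<k. (if i = 0 then a * cnj a else 0) + (if i = 1 then b * cnj b else 0))"
    unfolding scalar_prod_def by (rule sum.cong) (auto simp: pair_vec_def unit_vec_def)
  also have "\<dots> = a * cnj a + b * cnj b"
    using assms by (simp add: sum.distrib)
  finally show ?thesis by (simp add: complex_norm_square del: of_real_power)
qed

text \<open>The divisions by \<open>\<sigma> 0\<close> and \<open>\<sigma> 1\<close> undo the
  scaling by the singular values, so any prescribed combination of the first two left singular
  vectors has an explicit preimage under \<open>C\<close>.\<close>

lemma is_svd_pair_vec:
  fixes a b :: complex
  assumes svd: "is_svd C U \<sigma> V" and C: "C \<in> carrier_mat n r" and "2 \<le> n" "2 \<le> r"
    and pos: "0 < \<sigma> 0" "0 < \<sigma> 1"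
  shows "C *\<^sub>v (V *\<^sub>v pair_vec r (a / \<sigma> 0) (b / \<sigma> 1)) = U *\<^sub>v pair_vec n a b"
proof -
  have "vec n (\<lambda>i. if i < r then complex_of_real (\<sigma> i) * pair_vec r (a / \<sigma> 0) (b / \<sigma> 1) $ i else 0)
      = pair_vec n a b"
    using assms by (intro eq_vecI) (auto simp: pair_vec_def unit_vec_def)
  then show ?thesis
    unfolding is_svd_mult_vec[OF svd C pair_vec_carrier] by (rule arg_cong)
qed

section \<open>From kernel vectors of \<open>M_mat\<close> to the real constraints\<close>

lemma M_mat_kernel:
  assumes A: "A \<in> carrier_mat n n" and Q2: "Q2 \<in> carrier_mat n k" and X: "X \<in> carrier_mat n j"
    and z: "z \<in> carrier_vec n" and w: "w \<in> carrier_vec j"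
    and ker: "M_mat A Q2 X l *\<^sub>v (z @\<^sub>v w) = 0\<^sub>v (k + j)"
  shows "(cmat Q2)\<^sup>T *\<^sub>v (cmat A *\<^sub>v z - l \<cdot>\<^sub>v z - cmat X *\<^sub>v w) = 0\<^sub>v k"
    and "(cmat X)\<^sup>T *\<^sub>v z = 0\<^sub>v j"
proof -
  let ?Q = "(cmat Q2)\<^sup>T" and ?B = "cmat A - l \<cdot>\<^sub>m 1\<^sub>m n"
  have Q: "?Q \<in> carrier_mat k n" and B: "?B \<in> carrier_mat n n" and cX: "cmat X \<in> carrier_mat n j"
    and XT: "(cmat X)\<^sup>T \<in> carrier_mat j n" and cA: "cmat A \<in> carrier_mat n n"
    using A Q2 X by auto
  have QB: "?Q * ?B \<in> carrier_mat k n" and QX: "?Q * cmat X \<in> carrier_mat k j"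
    using Q B cX by auto
  \<comment> \<open>Block multiplication gives one vector per block row. The remaining steps drop
    the zero block and pull the common factor \<open>?Q\<close> out of the first one.\<close>
  have "M_mat A Q2 X l *\<^sub>v (z @\<^sub>v w) = (?Q * ?B *\<^sub>v z + - (?Q * cmat X) *\<^sub>v w) @\<^sub>v
      ((cmat X)\<^sup>T *\<^sub>v z + 0\<^sub>m j j *\<^sub>v w)"
    unfolding M_mat_def using four_block_mat_mult_vec[OF QB _ XT _ z w, of "- (?Q * cmat X)" "0\<^sub>m j j"]
      A X QX by simp
  also have "(cmat X)\<^sup>T *\<^sub>v z + 0\<^sub>m j j *\<^sub>v w = (cmat X)\<^sup>T *\<^sub>v z"
    using w X by (intro eq_vecI) auto
  also have "?Q * ?B *\<^sub>v z + - (?Q * cmat X) *\<^sub>v w = ?Q *\<^sub>v (?B *\<^sub>v z) - ?Q *\<^sub>v (cmat X *\<^sub>v w)"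
  proof -
    have "- (?Q * cmat X) *\<^sub>v w = - (?Q *\<^sub>v (cmat X *\<^sub>v w))"
      unfolding assoc_mult_mat_vec[OF Q cX w, symmetric]
      by (rule uminus_mult_mat_vec) (use w QX in auto)
    moreover have "u + - v = u - v" if "dim_vec u = dim_vec v" for u v :: "complex vec"
      using that by (intro eq_vecI) auto
    ultimately show ?thesis
      by (simp only: assoc_mult_mat_vec[OF Q B z] dim_mult_mat_vec)
  qed
  also have "?Q *\<^sub>v (?B *\<^sub>v z) - ?Q *\<^sub>v (cmat X *\<^sub>v w) = ?Q *\<^sub>v (?B *\<^sub>v z - cmat X *\<^sub>v w)"
    using mult_minus_distrib_mat_vec[OF Q, of "?B *\<^sub>v z" "cmat X *\<^sub>v w"] B z cX w by simp
  also have "?B *\<^sub>v z = cmat A *\<^sub>v z - l \<cdot>\<^sub>v z"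
  proof -
    have "(l \<cdot>\<^sub>m 1\<^sub>m n) *\<^sub>v z = l \<cdot>\<^sub>v z"
      using z by (intro eq_vecI) (auto simp: row_smult)
    then show ?thesis
      using minus_mult_distrib_mat_vec[OF cA _ z, of "l \<cdot>\<^sub>m 1\<^sub>m n"] by simp
  qed
  finally have "(?Q *\<^sub>v (cmat A *\<^sub>v z - l \<cdot>\<^sub>v z - cmat X *\<^sub>v w)) @\<^sub>v ((cmat X)\<^sup>T *\<^sub>v z)
      = 0\<^sub>v (k + j)"
    using ker by simp
  \<comment> \<open>The zero vector is split at the same place as the left-hand side, so that the
    two halves can be compared separately.\<close>
  also have "\<dots> = 0\<^sub>v k @\<^sub>v 0\<^sub>v j"
    by (intro eq_vecI) auto
  finally have eq: "(?Q *\<^sub>v (cmat A *\<^sub>v z - l \<cdot>\<^sub>v z - cmat X *\<^sub>v w)) @\<^sub>v ((cmat X)\<^sup>T *\<^sub>v z)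
      = 0\<^sub>v k @\<^sub>v 0\<^sub>v j" .
  have "?Q *\<^sub>v (cmat A *\<^sub>v z - l \<cdot>\<^sub>v z - cmat X *\<^sub>v w) \<in> carrier_vec k"
    by (rule carrier_vecI) (simp only: dim_mult_mat_vec carrier_matD(1)[OF Q])
  from append_vec_eq[OF this zero_carrier_vec, THEN iffD1, OF eq]
  show "?Q *\<^sub>v (cmat A *\<^sub>v z - l \<cdot>\<^sub>v z - cmat X *\<^sub>v w) = 0\<^sub>v k"
    "(cmat X)\<^sup>T *\<^sub>v z = 0\<^sub>v j"
    by simp_all
qed

text \<open>For \<open>z = x + i y\<close>, multiplication by
  \<open>Complex \<alpha> \<beta>\<close> has real part \<open>\<alpha> x - \<beta> y\<close> and
  imaginary part \<open>\<beta> x + \<alpha> y\<close>, which are the columns of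
  \<open>[x y]\<close> times the 2 by 2 block. All other matrices are real and commute with taking
  parts, so the two columns are the real and imaginary parts of the complex kernel
  equations.\<close>

lemma M_mat_kernel_real_form:
  fixes z w :: "complex vec"
  assumes A: "A \<in> carrier_mat n n" and Q2: "Q2 \<in> carrier_mat n k" and X: "X \<in> carrier_mat n j"
    and z: "z \<in> carrier_vec n" and w: "w \<in> carrier_vec j"
    and ker: "M_mat A Q2 X (Complex \<alpha> \<beta>) *\<^sub>v (z @\<^sub>v w) = 0\<^sub>v (k + j)"
  defines "x12 \<equiv> mat_of_cols n [map_vec Re z, map_vec Im z]"
    and "v12 \<equiv> mat_of_cols j [map_vec Re w, map_vec Im w]"
  shows "Q2\<^sup>T * (A * x12 - X * v12 - x12 * mat_of_rows_list 2 [[\<alpha>, \<beta>], [- \<beta>, \<alpha>]]) = 0\<^sub>m k 2"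
    and "X\<^sup>T * x12 = 0\<^sub>m j 2"
proof -
  define u where "u = cmat A *\<^sub>v z - Complex \<alpha> \<beta> \<cdot>\<^sub>v z - cmat X *\<^sub>v w"
  have u: "u \<in> carrier_vec n" 
    unfolding u_def by (rule carrier_vecI) (use X in simp)
  note k = M_mat_kernel[OF A Q2 X z w ker, folded u_def]
  have T: "(cmat Y)\<^sup>T = cmat (Y\<^sup>T)" for Y by (rule eq_matI) auto
  have re0: "map_vec Re (0\<^sub>v l) = 0\<^sub>v l" "map_vec Im (0\<^sub>v l) = 0\<^sub>v l" for l by auto
  have QT: "Q2\<^sup>T \<in> carrier_mat k n" and XT: "X\<^sup>T \<in> carrier_mat j n" using Q2 X by auto
  have cols0: "mat_of_cols l [0\<^sub>v l, 0\<^sub>v l] = (0\<^sub>m l 2 :: real mat)" for l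
    by (rule eq_matI) (auto simp: mat_of_cols_index less_2_cases_iff)
  have Qu: "Q2\<^sup>T *\<^sub>v map_vec Re u = 0\<^sub>v k" "Q2\<^sup>T *\<^sub>v map_vec Im u = 0\<^sub>v k"
    using map_vec_Re_cmat_mult[OF QT u] map_vec_Im_cmat_mult[OF QT u] k(1) by (simp_all add: T re0)
  have Xz: "X\<^sup>T *\<^sub>v map_vec Re z = 0\<^sub>v j" "X\<^sup>T *\<^sub>v map_vec Im z = 0\<^sub>v j"
    using map_vec_Re_cmat_mult[OF XT z] map_vec_Im_cmat_mult[OF XT z] k(2) by (simp_all add: T re0)
  have "A * x12 - X * v12 - x12 * mat_of_rows_list 2 [[\<alpha>, \<beta>], [- \<beta>, \<alpha>]]
      = mat_of_cols n [map_vec Re u, map_vec Im u]"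
  proof (rule eq_matI)
    fix i l assume "i < dim_row (mat_of_cols n [map_vec Re u, map_vec Im u])"
      "l < dim_col (mat_of_cols n [map_vec Re u, map_vec Im u])"
    then have i: "i < n" and l: "l = 0 \<or> l = 1" by auto
    have Ax: "A * x12 = mat_of_cols n [map_vec Re (cmat A *\<^sub>v z), map_vec Im (cmat A *\<^sub>v z)]"
      unfolding x12_def using z
      by (simp add: mult_mat_of_cols[OF A] map_vec_Re_cmat_mult[OF A z] map_vec_Im_cmat_mult[OF A z])
    have Xv: "X * v12 = mat_of_cols n [map_vec Re (cmat X *\<^sub>v w), map_vec Im (cmat X *\<^sub>v w)]"
      unfolding v12_def using w
      by (simp add: mult_mat_of_cols[OF X] map_vec_Re_cmat_mult[OF X w] map_vec_Im_cmat_mult[OF X w])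
    have xD: "(x12 * mat_of_rows_list 2 [[\<alpha>, \<beta>], [- \<beta>, \<alpha>]]) $$ (i, l) =
        (if l = 0 then Re (Complex \<alpha> \<beta> * z $ i) else Im (Complex \<alpha> \<beta> * z $ i))"
      using i l z
      by (auto simp: x12_def mat_of_rows_list_def scalar_prod_def numeral_2_eq_2 mat_of_cols_index)
    show "(A * x12 - X * v12 - x12 * mat_of_rows_list 2 [[\<alpha>, \<beta>], [- \<beta>, \<alpha>]]) $$ (i, l)
        = mat_of_cols n [map_vec Re u, map_vec Im u] $$ (i, l)"
      using i l u z w A X xD unfolding Ax Xv u_def
      by (auto simp: mat_of_cols_index x12_def mat_of_rows_list_def)
  qed (use A X in \<open>auto simp: x12_def v12_def mat_of_rows_list_def\<close>)
  then show "Q2\<^sup>T * (A * x12 - X * v12 - x12 * mat_of_rows_list 2 [[\<alpha>, \<beta>], [- \<beta>, \<alpha>]]) = 0\<^sub>m k 2"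
    using u by (simp add: mult_mat_of_cols[OF QT] Qu cols0)
  show "X\<^sup>T * x12 = 0\<^sub>m j 2"
    unfolding x12_def using z by (simp add: mult_mat_of_cols[OF XT] Xz cols0)
qed

lemma gram_mat_of_two_cols:
  assumes "x \<in> carrier_vec n" "y \<in> carrier_vec n" "x \<bullet> y = (0 :: real)"
  shows "(mat_of_cols n [x, y])\<^sup>T * mat_of_cols n [x, y]
    = mat_of_rows_list 2 [[x \<bullet> x, 0], [0, y \<bullet> y]]"
  using assms comm_scalar_prod[OF assms(1,2)]
  by (intro eq_matI) (auto simp: mat_of_rows_list_def numeral_2_eq_2 less_Suc_eq)

section \<open>Existence of admissible coefficients and the objective bound\<close>

theorem theorem3p2:
  fixes n m j r :: nat
    and A B Q Q1 Q2 R X T D\<^sub>0 Xt Yt \<Omega> :: "real mat"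
    and \<alpha> \<beta> :: real
    and M S S1 S2 U V :: "complex mat"
    and \<sigma> :: "nat \<Rightarrow> real"
    and z1 z2 w1 w2 :: "complex vec"
    and p1 p2 q1 q2 :: "real vec"
  assumes A: "A \<in> carrier_mat n n"
    and B: "B \<in> carrier_mat n m" "vec_space.rank n B = m"
    and ctrb: "controllable A B"
    and Q1: "Q1 \<in> carrier_mat n m" and Q2: "Q2 \<in> carrier_mat n (n - m)"
    and Q: "Q \<in> carrier_mat n n" "Q = Q1 @\<^sub>c Q2" "real_orthogonal Q"
    and R: "R \<in> carrier_mat m m" "upper_triangular R" "invertible_mat R"
    and QR: "B = Q * (R @\<^sub>r 0\<^sub>m (n - m) m)"
    and j: "1 \<le> j" "j + 2 \<le> n"
    and X: "X \<in> carrier_mat n j"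
    and T: "T \<in> carrier_mat j j" "upper_quasi_triangular T"
    and XT: "Q2\<^sup>T * (A * X - X * T) = 0\<^sub>m (n - m) j"
    and XX: "X\<^sup>T * X = 1\<^sub>m j"
    and beta: "\<beta> \<noteq> 0"
    and D0: "D\<^sub>0 = mat_of_rows_list 2 [[\<alpha>, \<beta>], [- \<beta>, \<alpha>]]"
    and M: "M = M_mat A Q2 X (Complex \<alpha> \<beta>)"
    and r: "r = kernel_dim M" "2 \<le> r"
    and S1: "S1 \<in> carrier_mat n r" and S2: "S2 \<in> carrier_mat j r"
    and S: "S = S1 @\<^sub>r S2" "orthonormal_kernel_basis M S"
    and svd: "is_svd S1 U \<sigma> V"
    and sigma_pos: "0 < \<sigma> 0" "0 < \<sigma> 1"
    and z1: "z1 = U *\<^sub>v unit_vec n 0"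
    and w1: "w1 = complex_of_real (1 / \<sigma> 0) \<cdot>\<^sub>v (S2 *\<^sub>v (V *\<^sub>v unit_vec r 0))"
    and z2: "z2 = U *\<^sub>v unit_vec n 1"
    and w2: "w2 = complex_of_real (1 / \<sigma> 1) \<cdot>\<^sub>v (S2 *\<^sub>v (V *\<^sub>v unit_vec r 1))"
    and Xt: "Xt = mat_of_cols n [map_vec Re z1, map_vec Re z2]"
    and Yt: "Yt = mat_of_cols n [map_vec Im z1, map_vec Im z2]"
    and pq: "p1 \<in> carrier_vec 2" "q1 \<in> carrier_vec 2" "p2 \<in> carrier_vec 2" "q2 \<in> carrier_vec 2"
    and sv: "smallest_two_right_singular_vectors (Yt @\<^sub>c Xt) (p1 @\<^sub>v q1) (p2 @\<^sub>v q2)"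
    and Omega: "\<Omega> = Omega_mat p1 q1 p2 q2" "real_orthogonal \<Omega>"
  shows "(\<exists>\<mu>1 \<mu>2 \<nu>1 \<nu>2 \<gamma>1 \<gamma>2 \<zeta>1 \<zeta>2 x y.
            admissible \<Omega> z1 z2 \<mu>1 \<mu>2 \<nu>1 \<nu>2 \<gamma>1 \<gamma>2 \<zeta>1 \<zeta>2 x y) \<and>
         (\<forall>\<mu>1 \<mu>2 \<nu>1 \<nu>2 \<gamma>1 \<gamma>2 \<zeta>1 \<zeta>2 x y.
            admissible \<Omega> z1 z2 \<mu>1 \<mu>2 \<nu>1 \<nu>2 \<gamma>1 \<gamma>2 \<zeta>1 \<zeta>2 x y \<longrightarrow>
            (let w = combine w1 w2 \<gamma>1 \<gamma>2 \<zeta>1 \<zeta>2;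
                 v1 = map_vec Re w; v2 = map_vec Im w;
                 x12 = mat_of_cols n [x, y];
                 v12 = mat_of_cols j [v1, v2];
                 \<delta>1 = 1 / l2_norm x; \<delta>2 = 1 / l2_norm y
             in Q2\<^sup>T * (A * x12 - X * v12 - x12 * D\<^sub>0) = 0\<^sub>m (n - m) 2 \<and>
                X\<^sup>T * x12 = 0\<^sub>m j 2 \<and>
                x12\<^sup>T * x12 = mat_of_rows_list 2 [[1 / \<delta>1\<^sup>2, 0], [0, 1 / \<delta>2\<^sup>2]] \<and>
                (l2_norm (\<delta>1 \<cdot>\<^sub>v v1))\<^sup>2 + (l2_norm (\<delta>2 \<cdot>\<^sub>v v2))\<^sup>2
                  + \<beta>\<^sup>2 * (\<delta>1 / \<delta>2 - \<delta>2 / \<delta>1)\<^sup>2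
                \<le> 2 * (1 - (\<sigma> 1)\<^sup>2) / (\<sigma> 1)\<^sup>2))"
proof -
  have U: "U \<in> carrier_mat n n" "mat_adjoint U * U = 1\<^sub>m n"
    and V: "V \<in> carrier_mat r r" "mat_adjoint V * V = 1\<^sub>m r"
    using svd S1 unfolding is_svd_def unitary_def by auto
  have n2: "2 \<le> n" using j by simp
  have le: "\<sigma> 1 \<le> \<sigma> 0" using svd S1 n2 r unfolding is_svd_def by auto
  have z12: "z1 \<in> carrier_vec n" "z2 \<in> carrier_vec n"
    and w12: "w1 \<in> carrier_vec j" "w2 \<in> carrier_vec j"
    unfolding z1 z2 w1 w2 using U V S2 by simp_all
  have zc: "combine z1 z2 \<gamma>1 \<gamma>2 \<zeta>1 \<zeta>2 = U *\<^sub>v pair_vec n (Complex \<gamma>1 \<zeta>1) (Complex \<gamma>2 \<zeta>2)"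
    for \<gamma>1 \<gamma>2 \<zeta>1 \<zeta>2
    unfolding combine_eq[OF z12] mult_mat_pair_vec[OF U(1)] unfolding z1 z2 ..
  \<comment> \<open>The factors \<open>1 / \<sigma> 0\<close> and \<open>1 / \<sigma> 1\<close> from
    \<open>w1\<close> and \<open>w2\<close> move into the coefficients. The result is
    \<open>S2\<close> applied to the same vector that \<open>S1\<close> maps to the combination of
    \<open>z1\<close> and \<open>z2\<close>.\<close>
  have wc: "combine w1 w2 \<gamma>1 \<gamma>2 \<zeta>1 \<zeta>2 =
      S2 *\<^sub>v (V *\<^sub>v pair_vec r (Complex \<gamma>1 \<zeta>1 / \<sigma> 0) (Complex \<gamma>2 \<zeta>2 / \<sigma> 1))"
    for \<gamma>1 \<gamma>2 \<zeta>1 \<zeta>2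
  proof -
    have Ve: "V *\<^sub>v unit_vec r i \<in> carrier_vec r" for i using V by simp
    show ?thesis
      unfolding combine_eq[OF w12] mult_mat_pair_vec[OF V(1)] unfolding w1 w2
      using mult_add_distrib_mat_vec[OF S2, of "_ \<cdot>\<^sub>v (V *\<^sub>v unit_vec r 0)" "_ \<cdot>\<^sub>v (V *\<^sub>v unit_vec r 1)"] Ve
      by (simp add: mult_mat_vec[OF S2] smult_smult_assoc)
  qed
  have norm_z: "combine z1 z2 \<gamma>1 \<gamma>2 \<zeta>1 \<zeta>2 \<bullet>c combine z1 z2 \<gamma>1 \<gamma>2 \<zeta>1 \<zeta>2
      = of_real (\<gamma>1\<^sup>2 + \<gamma>2\<^sup>2 + \<zeta>1\<^sup>2 + \<zeta>2\<^sup>2)" for \<gamma>1 \<gamma>2 \<zeta>1 \<zeta>2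
    unfolding zc isometry_cscalar_prod[OF U pair_vec_carrier pair_vec_carrier]
      pair_vec_cscalar_prod[OF n2] by (simp add: cmod_power2)
  show ?thesis
  proof (intro conjI allI impI)
    \<comment> \<open>These are the coefficients of the form
      \<open>(c1, c2) \<mapsto> z \<bullet> z\<close> for \<open>z = c1 z1 + c2 z2\<close>; the
      factor 2 comes from the symmetric cross terms.\<close>
    obtain c1 c2 where c: "(cmod c1)\<^sup>2 + (cmod c2)\<^sup>2 = 1"
      "(z1 \<bullet> z1) * c1\<^sup>2 + (2 * (z1 \<bullet> z2)) * c1 * c2 + (z2 \<bullet> z2) * c2\<^sup>2 = 0"
      by (rule binary_quadratic_form_isotropic)
    define z where "z = combine z1 z2 (Re c1) (Re c2) (Im c1) (Im c2)"
    define x y where "x = map_vec Re z" and "y = map_vec Im z"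
    have zeq: "z = c1 \<cdot>\<^sub>v z1 + c2 \<cdot>\<^sub>v z2"
      by (simp add: z_def combine_eq[OF z12])
    have "z \<bullet> z = (z1 \<bullet> z1) * c1\<^sup>2 + (2 * (z1 \<bullet> z2)) * c1 * c2 + (z2 \<bullet> z2) * c2\<^sup>2"
      unfolding zeq using z12 comm_scalar_prod[OF z12]
      by (simp add: add_scalar_prod_distrib[of _ n] scalar_prod_add_distrib[of _ n]
          algebra_simps power2_eq_square)
    then have "x \<bullet> x - y \<bullet> y = 0" and xy: "x \<bullet> y = 0"
      using c(2) scalar_prod_self_Re_Im[of z] by (simp_all add: complex_eq_iff x_def y_def)
    moreover have norm1: "(Re c1)\<^sup>2 + (Re c2)\<^sup>2 + (Im c1)\<^sup>2 + (Im c2)\<^sup>2 = 1"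
      using c(1) by (simp add: cmod_power2)
    \<comment> \<open>The isometry \<open>U\<close> makes the squared norms of \<open>x\<close> and
      \<open>y\<close> sum to 1; their difference is 0, so each equals 1/2.\<close>
    moreover have "complex_of_real (x \<bullet> x + y \<bullet> y) = of_real 1"
      using norm_z[of "Re c1" "Re c2" "Im c1" "Im c2"]
      unfolding norm1 z_def[symmetric] x_def y_def cscalar_prod_self_Re_Im .
    then have "x \<bullet> x + y \<bullet> y = 1" by (simp only: of_real_eq_iff)
    ultimately have "x \<bullet> x = 1 / 2" "y \<bullet> y = 1 / 2" by linarith+
    then have nrm: "l2_norm x = sqrt 2 / 2" "l2_norm y = sqrt 2 / 2"
      by (simp_all only: l2_norm_def real_sqrt_divide) (simp_all add: field_simps)
    \<comment> \<open>The relation in \<open>admissible\<close> expresses the four parameters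
      through the coefficients, so they are read off from the isotropic vector just found.\<close>
    define \<mu> where "\<mu> = \<Omega>\<^sup>T *\<^sub>v vec_of_list [Re c1, Re c2, Im c1, Im c2]"
    have "dim_vec \<mu> = 4" by (simp add: \<mu>_def Omega Omega_mat_def)
    then have "vec_of_list [\<mu> $ 0, \<mu> $ 1, \<mu> $ 2, \<mu> $ 3] = \<mu>"
      by (intro eq_vecI) (auto simp: eval_nat_numeral less_Suc_eq)
    then have "admissible \<Omega> z1 z2 (\<mu> $ 0) (\<mu> $ 1) (\<mu> $ 2) (\<mu> $ 3)
        (Re c1) (Re c2) (Im c1) (Im c2) x y"
      unfolding admissible_def using norm1 xy nrm by (simp only: \<mu>_def x_def y_def z_def)
    then show "\<exists>\<mu>1 \<mu>2 \<nu>1 \<nu>2 \<gamma>1 \<gamma>2 \<zeta>1 \<zeta>2 x y.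
        admissible \<Omega> z1 z2 \<mu>1 \<mu>2 \<nu>1 \<nu>2 \<gamma>1 \<gamma>2 \<zeta>1 \<zeta>2 x y"
      by blast
  next
    fix \<mu>1 \<mu>2 \<nu>1 \<nu>2 \<gamma>1 \<gamma>2 \<zeta>1 \<zeta>2 x y
    assume adm: "admissible \<Omega> z1 z2 \<mu>1 \<mu>2 \<nu>1 \<nu>2 \<gamma>1 \<gamma>2 \<zeta>1 \<zeta>2 x y"
    define c1 c2 where "c1 = Complex \<gamma>1 \<zeta>1" and "c2 = Complex \<gamma>2 \<zeta>2"
    define z where "z = combine z1 z2 \<gamma>1 \<gamma>2 \<zeta>1 \<zeta>2"
    define w where "w = combine w1 w2 \<gamma>1 \<gamma>2 \<zeta>1 \<zeta>2"
    \<comment> \<open>With this scaling \<open>d = V f\<close> satisfies \<open>S1 d = z\<close> and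
      \<open>S2 d = w\<close>, so the stacked vector is \<open>S d\<close> and lies in the kernel of
      \<open>M\<close>.\<close>
    define f where "f = pair_vec r (c1 / \<sigma> 0) (c2 / \<sigma> 1)"
    define d where "d = V *\<^sub>v f"
    have xy: "x = map_vec Re z" "y = map_vec Im z" "x \<bullet> y = 0"
      and c: "(cmod c1)\<^sup>2 + (cmod c2)\<^sup>2 = 1"
      using adm unfolding admissible_def z_def by (auto simp: c1_def c2_def cmod_power2)
    note nrm = admissible_norms[OF adm]
    have f: "f \<in> carrier_vec r" by (simp add: f_def)
    then have d: "d \<in> carrier_vec r" using V by (simp add: d_def)
    have S1d: "S1 *\<^sub>v d = z"
      unfolding d_def f_def z_def zc c1_def c2_def
      by (rule is_svd_pair_vec[OF svd S1 n2 r(2) sigma_pos])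
    have S2d: "S2 *\<^sub>v d = w"
      unfolding d_def f_def w_def wc c1_def c2_def ..
    have Sd: "S *\<^sub>v d = z @\<^sub>v w"
      unfolding S(1) mat_mult_append[OF S1 S2 d] S1d S2d ..
    have z: "z \<in> carrier_vec n" and w: "w \<in> carrier_vec j"
      using S1 S2 d unfolding S1d[symmetric] S2d[symmetric] by simp_all
    have x: "x \<in> carrier_vec n" and y: "y \<in> carrier_vec n"
      using z unfolding xy by simp_all
    have Mc: "M \<in> carrier_mat (n - m + j) (n + j)"
      unfolding M M_mat_def using A Q2 X by auto
    have Sc: "S \<in> carrier_mat (n + j) r" unfolding S(1) using S1 S2 by simp
    have ker: "M_mat A Q2 X (Complex \<alpha> \<beta>) *\<^sub>v (z @\<^sub>v w) = 0\<^sub>v (n - m + j)"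
      using orthonormal_kernel_basis_mult[OF Mc Sc S(2) d] unfolding Sd M .
    have SS: "mat_adjoint S * S = 1\<^sub>m r"
      using S(2) Sc unfolding orthonormal_kernel_basis_def by auto
    have "z \<bullet>c z + w \<bullet>c w = f \<bullet>c f"
      unfolding cscalar_prod_append[OF z w, symmetric] Sd[symmetric] isometry_cscalar_prod[OF Sc SS d d]
      unfolding d_def isometry_cscalar_prod[OF V f f] ..
    also have "f \<bullet>c f = of_real ((cmod c1)\<^sup>2 / (\<sigma> 0)\<^sup>2 + (cmod c2)\<^sup>2 / (\<sigma> 1)\<^sup>2)"
      unfolding f_def pair_vec_cscalar_prod[OF r(2)] by (simp add: norm_divide power_divide)
    finally have "x \<bullet> x + y \<bullet> y + (map_vec Re w \<bullet> map_vec Re w + map_vec Im w \<bullet> map_vec Im w)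
        = (cmod c1)\<^sup>2 / (\<sigma> 0)\<^sup>2 + (cmod c2)\<^sup>2 / (\<sigma> 1)\<^sup>2"
      unfolding cscalar_prod_self_Re_Im xy(1,2) of_real_add[symmetric] of_real_eq_iff .
    \<comment> \<open>As \<open>\<sigma> 1 \<le> \<sigma> 0\<close>, replacing
      \<open>\<sigma> 0\<close> by \<open>\<sigma> 1\<close> can only enlarge the first
      quotient.\<close>
    also have "\<dots> \<le> (cmod c1)\<^sup>2 / (\<sigma> 1)\<^sup>2 + (cmod c2)\<^sup>2 / (\<sigma> 1)\<^sup>2"
      using le sigma_pos by (intro add_right_mono divide_left_mono power_mono) auto
    also have "\<dots> = 1 / (\<sigma> 1)\<^sup>2"
      using c by (simp flip: add_divide_distrib)
    finally have w_le: "map_vec Re w \<bullet> map_vec Re w + map_vec Im w \<bullet> map_vec Im w \<le> 1 / (\<sigma> 1)\<^sup>2 - 1"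
      using nrm by simp
    have len: "l2_norm x = sqrt 2 / 2" "l2_norm y = sqrt 2 / 2"
      using adm unfolding admissible_def by auto
    have scale: "(l2_norm ((1 / (sqrt 2 / 2)) \<cdot>\<^sub>v v))\<^sup>2 = 2 * (v \<bullet> v)" for v
      by (simp add: l2_norm_sq power2_eq_square[symmetric] power_divide)
    \<comment> \<open>Both scaling factors equal \<open>sqrt 2\<close>: the term with
      \<open>\<beta>\<close> vanishes, and the other two are twice the squared norm of
      \<open>w\<close>.\<close>
    have obj: "(l2_norm ((1 / l2_norm x) \<cdot>\<^sub>v map_vec Re w))\<^sup>2
        + (l2_norm ((1 / l2_norm y) \<cdot>\<^sub>v map_vec Im w))\<^sup>2
        + \<beta>\<^sup>2 * ((1 / l2_norm x) / (1 / l2_norm y) - (1 / l2_norm y) / (1 / l2_norm x))\<^sup>2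
        \<le> 2 * (1 - (\<sigma> 1)\<^sup>2) / (\<sigma> 1)\<^sup>2"
    proof -
      have "2 * (1 / (\<sigma> 1)\<^sup>2 - 1) = 2 * (1 - (\<sigma> 1)\<^sup>2) / (\<sigma> 1)\<^sup>2"
        using sigma_pos by (simp add: field_simps)
      then show ?thesis unfolding len scale using w_le by simp
    qed
    \<comment> \<open>Since division by zero yields zero, this holds even for a vector of norm
      0.\<close>
    have inv: "1 / (1 / l2_norm v)\<^sup>2 = v \<bullet> v" for v
      by (simp add: power_divide l2_norm_sq)
    show "let w = combine w1 w2 \<gamma>1 \<gamma>2 \<zeta>1 \<zeta>2;
                 v1 = map_vec Re w; v2 = map_vec Im w;
                 x12 = mat_of_cols n [x, y];
                 v12 = mat_of_cols j [v1, v2];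
                 \<delta>1 = 1 / l2_norm x; \<delta>2 = 1 / l2_norm y
             in Q2\<^sup>T * (A * x12 - X * v12 - x12 * D\<^sub>0) = 0\<^sub>m (n - m) 2 \<and>
                X\<^sup>T * x12 = 0\<^sub>m j 2 \<and>
                x12\<^sup>T * x12 = mat_of_rows_list 2 [[1 / \<delta>1\<^sup>2, 0], [0, 1 / \<delta>2\<^sup>2]] \<and>
                (l2_norm (\<delta>1 \<cdot>\<^sub>v v1))\<^sup>2 + (l2_norm (\<delta>2 \<cdot>\<^sub>v v2))\<^sup>2
                  + \<beta>\<^sup>2 * (\<delta>1 / \<delta>2 - \<delta>2 / \<delta>1)\<^sup>2
                \<le> 2 * (1 - (\<sigma> 1)\<^sup>2) / (\<sigma> 1)\<^sup>2"
      unfolding Let_def inv w_def[symmetric] D0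
      using M_mat_kernel_real_form[OF A Q2 X z w ker, folded xy(1,2)]
        gram_mat_of_two_cols[OF x y xy(3)] obj
      by (intro conjI)
  qed
qed

end
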